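(* Let $\gamma\in(-d,0)$, let $f_0\in L^1(\mathbb{R}^d)$ be a non-negative initial datum with unit mass and let $f(t,\cdot)$ denote the solution to $\partial_t f=\boldsymbol{L}_\gamma f$ with $f(0)=f_0$. For any $k\ge0$ there exist explicit constants $C_1>0$ and $C_{2,k}>0$ such that $$\|f(t)-\mathcal{M}\|_{L^1_k}\ \ge\ C_1\int_{|v|>t^{\frac{1}{|\gamma|}}}\langle v\rangle^kf_0(v)\,dv-C_{2,k}\exp\left(-\frac{t^{\frac{2}{|\gamma|}}}{4}\right)\qquad\forall\,t\ge0 .$$
   Context: Setting: $d\ge2$, $\gamma\in(-d,0)$; $b:[-1,1]\to[0,\infty)$ is an even function with $\|b\|_1:=\int_{\mathbb{S}^{d-1}}b(\cos\theta)\,d\sigma=|\mathbb{S}^{d-2}|\int_{-1}^1 b(x)(1-x^2)^{\frac{d-3}{2}}dx=1$. The Maxwellian is $\mathcal{M}(v)=(2\pi)^{-d/2}e^{-|v|^2/2}$. For $v,v_*\in\mathbb{R}^d$, $\sigma\in\mathbb{S}^{d-1}$: $v'=\frac{v+v_*}{2}+\frac{|v-v_*|}{2}\sigma$, $v_*'=\frac{v+v_*}{2}-\frac{|v-v_*|}{2}\sigma$, $\cos\theta=\frac{v-v_*}{|v-v_*|}\cdot\sigma$. The linear Boltzmann operator is $$\boldsymbol{L}_\gamma f(v)=\int_{\mathbb{R}^d\times\mathbb{S}^{d-1}}|v-v_*|^\gamma b(\cos\theta)\big(f(v')\mathcal{M}(v_*')-f(v)\mathcal{M}(v_* )\big)\,dv_*\,d\sigma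 .$$ It is bounded on $L^1(\mathbb{R}^d)$; the solution with initial datum $f_0\in L^1(\mathbb{R}^d)$ is $f(t)=U(t)f_0$, where $(U(t))_{t\ge0}$ is the positive, mass-preserving $C_0$-semigroup on $L^1(\mathbb{R}^d)$ generated by $\boldsymbol{L}_\gamma$. Notation: $\langle v\rangle=\sqrt{1+|v|^2}$, $\|f\|_{L^1_k}=\int_{\mathbb{R}^d}\langle v\rangle^k|f(v)|\,dv$ (possibly $+\infty$). *)

theory Defs
  imports "HOL-Analysis.Analysis"
begin

text \<open>
  The (unnormalised) surface measure is obtained from Lebesgue measure on the punctured unit ball
  by radial projection: in dimension \<open>d\<close>, a Borel set \<open>A\<close> of the sphere has
  surface measure \<open>d\<close> times the volume of the cone
  \<open>{x. 0 < norm x < 1 \<and> x / norm x \<in> A}\<close>, since the cone has volume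
  \<open>\<integral>\<^sub>0\<^sup>1 r ^ (d - 1) * \<sigma>(A) dr = \<sigma>(A) / d\<close>.
\<close>

definition sphere_measure :: "'a::euclidean_space measure" where
  "sphere_measure =
     scale_measure (of_nat DIM('a))
       (distr (restrict_space lborel (ball 0 1 - {0}))
              (restrict_space borel (sphere 0 1))
              (\<lambda>x. x /\<^sub>R norm x))"

lemma space_sphere_measure [simp]:
  "space (sphere_measure :: 'a::euclidean_space measure) = sphere 0 1"
  by (simp add: sphere_measure_def space_scale_measure space_restrict_space)

lemma sets_sphere_measure [simp, measurable_cong]:
  "sets (sphere_measure :: 'a::euclidean_space measure) = sets (restrict_space borel (sphere 0 1))"
  by (simp add: sphere_measure_def)

lemma emeasure_sphere_measure:
  fixes A :: "'a::euclidean_space set"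
  assumes "A \<in> sets borel" "A \<subseteq> sphere 0 1"
  shows "emeasure sphere_measure A =
           of_nat DIM('a) * emeasure lborel {x \<in> ball 0 1 - {0}. x /\<^sub>R norm x \<in> A}"
proof -
  have m: "(\<lambda>x::'a. x /\<^sub>R norm x)
             \<in> restrict_space lborel (ball 0 1 - {0}) \<rightarrow>\<^sub>M restrict_space borel (sphere 0 1)"
    by (rule measurable_restrict_space2)
       (auto simp: space_restrict_space intro!: measurable_restrict_space1)
  have s: "A \<in> sets (restrict_space borel (sphere (0::'a) 1))"
    using assms by (auto simp: sets_restrict_space)
  have "emeasure (restrict_space lborel (ball 0 1 - {0})) {x \<in> ball 0 1 - {0}. x /\<^sub>R norm x \<in> A}
        = emeasure lborel {x \<in> ball 0 1 - {0}. x /\<^sub>R norm x \<in> A}"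
    by (rule emeasure_restrict_space) auto
  moreover have "(\<lambda>x. x /\<^sub>R norm x) -` A \<inter> (ball 0 1 - {0}) =
      {x \<in> ball 0 1 - {0}. x /\<^sub>R norm x \<in> A}"
    by auto
  ultimately show ?thesis
    unfolding sphere_measure_def using m s
    by (simp only: emeasure_scale_measure emeasure_distr space_restrict_space space_lborel space_borel
                   sets_lborel Int_UNIV_right)
qed

definition maxwellian :: "'a::euclidean_space \<Rightarrow> real" where
  "maxwellian v = (2 * pi) powr (- real DIM('a) / 2) * exp (- (norm v)\<^sup>2 / 2)"

definition post_v :: "'a::euclidean_space \<Rightarrow> 'a \<Rightarrow> 'a \<Rightarrow> 'a" where
  "post_v v w \<sigma> = (1/2) *\<^sub>R (v + w) + (norm (v - w) / 2) *\<^sub>R \<sigma>"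

definition post_w :: "'a::euclidean_space \<Rightarrow> 'a \<Rightarrow> 'a \<Rightarrow> 'a" where
  "post_w v w \<sigma> = (1/2) *\<^sub>R (v + w) - (norm (v - w) / 2) *\<^sub>R \<sigma>"

definition cos_dev :: "'a::euclidean_space \<Rightarrow> 'a \<Rightarrow> 'a \<Rightarrow> real" where
  "cos_dev v w \<sigma> = ((v - w) /\<^sub>R norm (v - w)) \<bullet> \<sigma>"

text \<open>
  For integrable \<open>f\<close> the integrand below is absolutely integrable for almost every
  \<open>v\<close> only; on the exceptional null set the Bochner integral returns \<open>0\<close>.
  Likewise the integrand is \<open>0\<close> on the null set \<open>w = v\<close>.
\<close>

definition boltzmann_L ::
  "real \<Rightarrow> (real \<Rightarrow> real) \<Rightarrow> ('a::euclidean_space \<Rightarrow> real) \<Rightarrow> 'a \<Rightarrow> real" where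
  "boltzmann_L \<gamma> b f v =
     (\<integral>(w, \<sigma>). norm (v - w) powr \<gamma> * b (cos_dev v w \<sigma>) *
        (f (post_v v w \<sigma>) * maxwellian (post_w v w \<sigma>) - f v * maxwellian w)
      \<partial>(lborel \<Otimes>\<^sub>M sphere_measure))"

definition japanese :: "'a::euclidean_space \<Rightarrow> real" where
  "japanese v = sqrt (1 + (norm v)\<^sup>2)"

definition wL1_norm :: "real \<Rightarrow> ('a::euclidean_space \<Rightarrow> real) \<Rightarrow> ennreal" where
  "wL1_norm k f = (\<integral>\<^sup>+v. ennreal (japanese v powr k * \<bar>f v\<bar>) \<partial>lborel)"

definition L1_norm :: "('a::euclidean_space \<Rightarrow> real) \<Rightarrow> real" where
  "L1_norm f = (\<integral>v. \<bar>f v\<bar> \<partial>lborel)"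

text \<open>
  Elements of the Lebesgue space are represented by integrable functions, and identities in the
  space are identities almost everywhere. Linearity and boundedness together make an operator
  compatible with almost everywhere equality.
\<close>

definition L1_bounded_linear ::
  "(('a::euclidean_space \<Rightarrow> real) \<Rightarrow> 'a \<Rightarrow> real) \<Rightarrow> bool" where
  "L1_bounded_linear T \<longleftrightarrow>
     (\<forall>f. integrable lborel f \<longrightarrow> integrable lborel (T f)) \<and>
     (\<forall>f g. integrable lborel f \<longrightarrow> integrable lborel g \<longrightarrow>
        (AE v in lborel. T (\<lambda>x. f x + g x) v = T f v + T g v)) \<and>
     (\<forall>c f. integrable lborel f \<longrightarrow> (AE v in lborel. T (\<lambda>x. c * f x) v = c * T f v)) \<and>
     (\<exists>K. \<forall>f. integrable lborel f \<longrightarrow> L1_norm (T f) \<le> K * L1_norm f)"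

definition L1_C0_semigroup ::
  "(real \<Rightarrow> ('a::euclidean_space \<Rightarrow> real) \<Rightarrow> 'a \<Rightarrow> real) \<Rightarrow> bool" where
  "L1_C0_semigroup U \<longleftrightarrow>
     (\<forall>t\<ge>0. L1_bounded_linear (U t)) \<and>
     (\<forall>f. integrable lborel f \<longrightarrow> (AE v in lborel. U 0 f v = f v)) \<and>
     (\<forall>s\<ge>0. \<forall>t\<ge>0. \<forall>f. integrable lborel f \<longrightarrow>
        (AE v in lborel. U (s + t) f v = U s (U t f) v)) \<and>
     (\<forall>f. integrable lborel f \<longrightarrow> ((\<lambda>t. L1_norm (\<lambda>v. U t f v - f v)) \<longlongrightarrow> 0) (at_right 0))"

text \<open>
  The generator of \<open>U\<close> is the everywhere defined operator \<open>A\<close>: the difference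
  quotients at \<open>0\<close> converge in norm to \<open>A f\<close> for every integrable \<open>f\<close>. This is
  the right notion for an operator that is bounded on the whole space.
\<close>

definition L1_generates ::
  "(('a::euclidean_space \<Rightarrow> real) \<Rightarrow> 'a \<Rightarrow> real) \<Rightarrow>
   (real \<Rightarrow> ('a \<Rightarrow> real) \<Rightarrow> 'a \<Rightarrow> real) \<Rightarrow> bool" where
  "L1_generates A U \<longleftrightarrow>
     (\<forall>f. integrable lborel f \<longrightarrow>
        integrable lborel (A f) \<and>
        ((\<lambda>t. L1_norm (\<lambda>v. (U t f v - f v) / t - A f v)) \<longlongrightarrow> 0) (at_right 0))"

definition L1_positive ::
  "(real \<Rightarrow> ('a::euclidean_space \<Rightarrow> real) \<Rightarrow> 'a \<Rightarrow> real) \<Rightarrow> bool" where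
  "L1_positive U \<longleftrightarrow>
     (\<forall>t\<ge>0. \<forall>f. integrable lborel f \<longrightarrow> (AE v in lborel. 0 \<le> f v) \<longrightarrow>
        (AE v in lborel. 0 \<le> U t f v))"

definition L1_mass_preserving ::
  "(real \<Rightarrow> ('a::euclidean_space \<Rightarrow> real) \<Rightarrow> 'a \<Rightarrow> real) \<Rightarrow> bool" where
  "L1_mass_preserving U \<longleftrightarrow>
     (\<forall>t\<ge>0. \<forall>f. integrable lborel f \<longrightarrow>
        (\<integral>v. U t f v \<partial>lborel) = (\<integral>v. f v \<partial>lborel))"

end

theory Submission
  imports Defs
begin

text \<open>
  Fast particles hardly collide when the potential is soft, and this limits the rate of relaxation.
  The collision frequency at velocity \<open>v\<close> is at most \<open>a v = \<Lambda> * max 1 (norm v) powr \<gamma>\<close>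
  (\<open>collision_frequency_le\<close>): the kernel is locally integrable because \<open>\<gamma> > -d\<close>, and the
  Maxwellian gives very little mass to the neighbourhood of a large \<open>v\<close>. Dropping the non-negative
  gain term yields \<open>boltzmann_L \<gamma> b f \<ge> - a * f\<close> for \<open>f \<ge> 0\<close> (\<open>boltzmann_L_ge\<close>), and
  \<open>semigroup_ge_exp\<close> integrates this differential inequality to
  \<open>U t f0 \<ge> exp (- t * a) * f0\<close>.

  If \<open>norm v > t powr (1 / \<bar>\<gamma>\<bar>)\<close>, then \<open>t * a v \<le> \<Lambda>\<close>, and hence
  \<open>\<bar>U t f0 v - maxwellian v\<bar> \<ge> exp (- \<Lambda>) * f0 v - maxwellian v\<close>. Integrating against the weight
  over these velocities gives the estimate, where the Maxwellian contributes the Gaussian tail of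
  \<open>maxwellian_tail\<close>. The constant \<open>exp (- \<Lambda>)\<close> depends neither on the weight nor on the initial
  datum.
\<close>

section \<open>Moments of the Maxwellian and the collision frequency\<close>

lemma ennreal_le_suminf: "f n \<le> (\<Sum>n. f n :: ennreal)"
  using sum_le_suminf[of f "{n}"] by simp

text \<open>
  Local integrability of the kinetic kernel, which is where \<open>\<gamma> > -d\<close> enters. The punctured ball is
  cut into dyadic shells \<open>r / 2 ^ (n + 1) \<le> norm (v - w) < r / 2 ^ n\<close>. On such a shell the kernel is
  at most its value on the inner sphere, and the shell lies in a ball of volume proportional to
  \<open>(r / 2 ^ n) ^ d\<close>, so that the contributions form a geometric series of ratio
  \<open>2 powr - (\<gamma> + d)\<close>.
\<close>

lemma nn_integral_norm_powr_ball_le: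
  assumes "- real DIM('a::euclidean_space) < \<gamma>" "\<gamma> < 0"
  obtains C where "0 \<le> C"
    "\<And>(v::'a) r. 0 < r \<Longrightarrow>
       (\<integral>\<^sup>+w\<in>ball v r. ennreal (norm (v - w) powr \<gamma>) \<partial>lborel)
         \<le> ennreal (C * r powr (\<gamma> + real DIM('a)))"
proof -
  let ?d = "DIM('a)"
  define V where "V = unit_ball_vol (real ?d)"
  define q :: real where "q = 2 powr (- (\<gamma> + real ?d))"
  have V: "0 \<le> V" by (simp add: V_def)
  have q: "0 \<le> q" "q < 1"
    using assms powr_less_mono[of "- (\<gamma> + real ?d)" 0 2] by (auto simp: q_def)
  define C where "C = V * 2 powr (- \<gamma>) * (1 / (1 - q))"
  have "0 \<le> C" using V q by (simp add: C_def)
  moreover have "(\<integral>\<^sup>+w\<in>ball v r. ennreal (norm (v - w) powr \<gamma>) \<partial>lborel)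
         \<le> ennreal (C * r powr (\<gamma> + real ?d))" if r: "0 < r" for v :: 'a and r
  proof -
    define c where "c n = (r / 2 ^ Suc n) powr \<gamma>" for n
    have pt: "ennreal (norm (v - w) powr \<gamma>) * indicator (ball v r) w
        \<le> (\<Sum>n. ennreal (c n) * indicator (ball v (r / 2 ^ n)) w)" for w
    proof (cases "w \<in> ball v r \<and> w \<noteq> v")
      case True
      define x where "x = norm (v - w)"
      have x: "0 < x" "x < r" using True by (auto simp: x_def dist_norm)
      obtain N where "(1/2) ^ N < x / r"
        using real_arch_pow_inv[of "x / r" "1/2"] x r by auto
      then have "r / 2 ^ N < x" using r by (simp add: field_simps power_divide)
      then have ex: "r / 2 ^ Suc N \<le> x" using x r by (simp add: field_simps)
      define n where "n = (LEAST n. r / 2 ^ Suc n \<le> x)"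
      have n: "r / 2 ^ Suc n \<le> x"
        unfolding n_def using ex by (rule LeastI)
      have n': "x < r / 2 ^ n"
      proof (cases n)
        case (Suc m)
        then have "\<not> r / 2 ^ Suc m \<le> x"
          using not_less_Least[of m "\<lambda>n. r / 2 ^ Suc n \<le> x"] by (simp add: n_def)
        then show ?thesis using Suc by simp
      qed (use x in simp)
      have "x powr \<gamma> \<le> c n"
        unfolding c_def using n r assms by (intro powr_mono2') auto
      then have "ennreal (norm (v - w) powr \<gamma>) * indicator (ball v r) w
          \<le> ennreal (c n) * indicator (ball v (r / 2 ^ n)) w"
        using True n' by (auto simp: x_def dist_norm indicator_def intro!: ennreal_leI)
      also have "\<dots> \<le> (\<Sum>n. ennreal (c n) * indicator (ball v (r / 2 ^ n)) w)"
      by (rule ennreal_le_suminf)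
      finally show ?thesis .
    next
      case False
      then show ?thesis by (auto simp: indicator_def)
    qed
    have summand: "c n * (V * (r / 2 ^ n) ^ ?d)
        = V * 2 powr (- \<gamma>) * r powr (\<gamma> + real ?d) * q ^ n" for n
    proof -
      define y where "y = r / 2 ^ n"
      have y: "0 < y" using r by (simp add: y_def)
      have "c n = y powr \<gamma> * 2 powr (- \<gamma>)"
        using y by (simp add: c_def y_def powr_divide powr_minus powr_mult field_simps)
      moreover have "y ^ ?d = y powr real ?d"
        using y by (simp add: powr_realpow)
      moreover have "y powr \<gamma> * y powr real ?d = y powr (\<gamma> + real ?d)"
        by (simp add: powr_add)
      moreover have "y powr (\<gamma> + real ?d) = r powr (\<gamma> + real ?d) * q ^ n"
      proof -
        have "(2 ^ n) powr (\<gamma> + real ?d) = (2::real) powr (real n * (\<gamma> + real ?d))"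
          by (simp flip: powr_realpow add: powr_powr)
        moreover have "q ^ n = 2 powr (- (real n * (\<gamma> + real ?d)))"
          using powr_powr[of 2 "- (\<gamma> + real ?d)" "real n"]
          by (simp add: q_def powr_realpow[symmetric] algebra_simps)
        ultimately show ?thesis
          using r by (simp add: y_def powr_divide powr_minus_divide)
      qed
      ultimately show ?thesis
        by (simp add: y_def[symmetric] mult.assoc mult.left_commute)
    qed
    have "(\<integral>\<^sup>+w\<in>ball v r. ennreal (norm (v - w) powr \<gamma>) \<partial>lborel)
        \<le> (\<integral>\<^sup>+w. (\<Sum>n. ennreal (c n) * indicator (ball v (r / 2 ^ n)) w) \<partial>lborel)"
      by (intro nn_integral_mono pt)
    also have "\<dots> = (\<Sum>n. \<integral>\<^sup>+w. ennreal (c n) * indicator (ball v (r / 2 ^ n)) w \<partial>lborel)"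
      by (intro nn_integral_suminf borel_measurable_times_ennreal borel_measurable_indicator) auto
    also have "\<dots> = (\<Sum>n. ennreal (c n * (V * (r / 2 ^ n) ^ ?d)))"
      using r V by (intro suminf_cong)
        (simp add: nn_integral_cmult_indicator emeasure_ball V_def ennreal_mult c_def)
    also have "\<dots> = ennreal (V * 2 powr (- \<gamma>) * r powr (\<gamma> + real ?d) * (1 / (1 - q)))"
      unfolding summand using q V r
      by (intro suminf_ennreal_eq sums_mult geometric_sums) auto
    finally show ?thesis
      by (simp add: C_def mult_ac)
  qed
  ultimately show ?thesis by (rule that)
qed

text \<open>
  The unit shell \<open>n \<le> norm v < n + 1\<close> lies in a ball of volume proportional to \<open>(n + 1) ^ d\<close>, so the
  exponent \<open>d + 2\<close> leaves the convergent series of \<open>1 / (n + 1)\<^sup>2\<close>. This is all the radial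
  integration that Gaussian moments require.
\<close>

lemma nn_integral_inverse_polynomial_finite:
  "(\<integral>\<^sup>+(v::'a::euclidean_space). ennreal (inverse ((1 + norm v) ^ (DIM('a) + 2))) \<partial>lborel) < \<infinity>"
proof -
  let ?d = "DIM('a)"
  define V where "V = unit_ball_vol (real ?d)"
  have V: "0 \<le> V" by (simp add: V_def)
  define c :: "nat \<Rightarrow> real" where "c n = inverse (real (Suc n) ^ (?d + 2))" for n
  have pt: "ennreal (inverse ((1 + norm v) ^ (?d + 2)))
      \<le> (\<Sum>n. ennreal (c n) * indicator (ball 0 (real (Suc n))) v)" for v :: 'a
  proof -
    define n where "n = nat \<lfloor>norm v\<rfloor>"
    have "real n = of_int \<lfloor>norm v\<rfloor>" by (simp add: n_def)
    then have n: "real n \<le> norm v" "norm v < real (Suc n)"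
      by linarith+
    have "inverse ((1 + norm v) ^ (?d + 2)) \<le> c n"
      unfolding c_def using n by (intro le_imp_inverse_le power_mono) auto
    then have "ennreal (inverse ((1 + norm v) ^ (?d + 2)))
        \<le> ennreal (c n) * indicator (ball 0 (real (Suc n))) v"
      using n by (auto simp: indicator_def intro!: ennreal_leI)
    also have "\<dots> \<le> (\<Sum>n. ennreal (c n) * indicator (ball 0 (real (Suc n))) v)"
      by (rule ennreal_le_suminf)
    finally show ?thesis .
  qed
  have "(\<integral>\<^sup>+(v::'a). ennreal (inverse ((1 + norm v) ^ (?d + 2))) \<partial>lborel)
      \<le> (\<integral>\<^sup>+(v::'a). (\<Sum>n. ennreal (c n) * indicator (ball 0 (real (Suc n))) v) \<partial>lborel)"
    by (intro nn_integral_mono pt)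
  also have "\<dots> = (\<Sum>n. \<integral>\<^sup>+(v::'a). ennreal (c n) * indicator (ball 0 (real (Suc n))) v \<partial>lborel)"
    by (intro nn_integral_suminf borel_measurable_times_ennreal borel_measurable_indicator) auto
  also have "\<dots> = (\<Sum>n. ennreal (c n * (V * real (Suc n) ^ ?d)))"
    using V by (intro suminf_cong)
      (simp add: nn_integral_cmult_indicator emeasure_ball V_def ennreal_mult c_def del: of_nat_Suc)
  also have "\<dots> = (\<Sum>n. ennreal (V * inverse (real (Suc n) ^ 2)))"
    by (intro suminf_cong) (simp add: c_def power_add power2_eq_square field_simps del: of_nat_Suc)
  also have "\<dots> = ennreal (\<Sum>n. V * inverse (real (Suc n) ^ 2))"
    using V inverse_power_summable[of 2, where 'a = real]
    by (intro suminf_ennreal2 summable_mult)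
       (auto simp: summable_Suc_iff[of "\<lambda>n. inverse (real n ^ 2)"] simp del: of_nat_Suc)
  also have "\<dots> < \<infinity>" by simp
  finally show ?thesis .
qed

text \<open>
  The power series of the exponential gives \<open>(1 + r) ^ N \<le> fact N * exp (1 + r)\<close>, and the Gaussian
  outweighs the linear exponent. The rate \<open>1/8\<close> is the one at which the Maxwellian decays at distance
  \<open>r / 2\<close> from the origin.
\<close>

lemma power_mult_gaussian_le:
  fixes r :: real
  assumes "0 \<le> r"
  shows "(1 + r) ^ N * exp (- r\<^sup>2 / 8) \<le> fact N * exp 3"
proof -
  have "(\<Sum>n\<in>{N}. (1 + r) ^ n /\<^sub>R fact n) \<le> exp (1 + r)"
    using exp_converges[of "1 + r"] assms
    by (intro order_trans[OF sum_le_suminf[of _ "{N}"]]) (auto simp: sums_iff)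
  then have "(1 + r) ^ N \<le> fact N * exp (1 + r)"
    by (simp add: field_simps)
  then have "(1 + r) ^ N * exp (- r\<^sup>2 / 8) \<le> fact N * exp (1 + r) * exp (- r\<^sup>2 / 8)"
    by (intro mult_right_mono) auto
  also have "\<dots> = fact N * exp (1 + r - r\<^sup>2 / 8)"
    by (simp add: mult.assoc flip: exp_add)
  also have "\<dots> \<le> fact N * exp 3"
    \<comment> \<open>The exponent is at most \<open>3\<close> by completing the square.\<close>
    using zero_le_power2[of "r - 4"]
    by (intro mult_left_mono) (auto simp: power2_eq_square algebra_simps)
  finally show ?thesis .
qed

lemma nn_integral_japanese_gaussian_finite:
  assumes "0 \<le> k"
  shows "(\<integral>\<^sup>+(v::'a::euclidean_space). ennreal (japanese v powr k * exp (- (norm v)\<^sup>2 / 4)) \<partial>lborel) < \<infinity>"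
proof -
  define M where "M = DIM('a) + 2"
  define N where "N = nat \<lceil>k\<rceil> + M"
  have pt: "japanese v powr k * exp (- (norm v)\<^sup>2 / 4)
      \<le> fact N * exp 3 * inverse ((1 + norm v) ^ M)" for v :: 'a
  proof -
    define r where "r = norm v"
    have r: "0 \<le> r" by (simp add: r_def)
    have "japanese v \<le> 1 + r"
      using r by (auto simp: japanese_def r_def power2_eq_square algebra_simps intro!: real_le_lsqrt)
    then have "japanese v powr k \<le> (1 + r) powr k"
      using assms by (intro powr_mono2) (auto simp: japanese_def)
    also have "\<dots> \<le> (1 + r) powr real (nat \<lceil>k\<rceil>)"
      using r assms by (intro powr_mono) auto
    also have "\<dots> = (1 + r) ^ nat \<lceil>k\<rceil>"
      using r by (simp add: powr_realpow)
    also have "\<dots> = (1 + r) ^ N * inverse ((1 + r) ^ M)"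
      using r by (simp add: N_def power_add)
    finally have 1: "japanese v powr k \<le> (1 + r) ^ N * inverse ((1 + r) ^ M)" .
    have "japanese v powr k * exp (- r\<^sup>2 / 4)
        \<le> ((1 + r) ^ N * inverse ((1 + r) ^ M)) * exp (- r\<^sup>2 / 8)"
      using r by (intro mult_mono 1) auto
    also have "\<dots> = ((1 + r) ^ N * exp (- r\<^sup>2 / 8)) * inverse ((1 + r) ^ M)"
      by simp
    also have "\<dots> \<le> fact N * exp 3 * inverse ((1 + r) ^ M)"
      using r by (intro mult_right_mono power_mult_gaussian_le) auto
    finally show ?thesis by (simp add: r_def)
  qed
  have "(\<integral>\<^sup>+(v::'a). ennreal (japanese v powr k * exp (- (norm v)\<^sup>2 / 4)) \<partial>lborel)
      \<le> (\<integral>\<^sup>+(v::'a). ennreal (fact N * exp 3) * ennreal (inverse ((1 + norm v) ^ M)) \<partial>lborel)"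
    using pt by (intro nn_integral_mono) (auto simp flip: ennreal_mult intro!: ennreal_leI)
  also have "\<dots> = ennreal (fact N * exp 3)
      * (\<integral>\<^sup>+(v::'a). ennreal (inverse ((1 + norm v) ^ M)) \<partial>lborel)"
    by (intro nn_integral_cmult) auto
  also have "\<dots> < \<infinity>"
    using nn_integral_inverse_polynomial_finite[where 'a = 'a]
    by (simp add: M_def ennreal_mult_less_top)
  finally show ?thesis .
qed

lemma maxwellian_nonneg: "0 \<le> maxwellian v"
  by (simp add: maxwellian_def)

lemma maxwellian_measurable [measurable]: "maxwellian \<in> borel_measurable borel"
  unfolding maxwellian_def by measurable

lemma japanese_measurable [measurable]: "japanese \<in> borel_measurable borel"
  unfolding japanese_def by measurable

text \<open>
  Half of the Gaussian exponent is evaluated at the boundary \<open>norm v = R\<close>, which produces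
  \<open>exp (- R\<^sup>2 / 4)\<close>; the other half absorbs the weight.
\<close>

lemma maxwellian_tail:
  fixes k :: real
  assumes "0 \<le> k"
  obtains K where "0 < K"
    "\<And>R. 0 \<le> R \<Longrightarrow> (\<integral>\<^sup>+v\<in>{v::'a::euclidean_space. R < norm v}.
       ennreal (japanese v powr k * maxwellian v) \<partial>lborel) \<le> ennreal (K * exp (- R\<^sup>2 / 4))"
proof -
  define c where "c = (2 * pi) powr (- real DIM('a) / 2)"
  have c: "0 \<le> c" by (simp add: c_def)
  define I where "I = (\<integral>\<^sup>+(v::'a). ennreal (japanese v powr k * exp (- (norm v)\<^sup>2 / 4)) \<partial>lborel)"
  have "I < \<infinity>"
    unfolding I_def by (rule nn_integral_japanese_gaussian_finite[OF assms])
  then obtain G where G: "I = ennreal G" "0 \<le> G"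
    by (cases I) auto
  have "(\<integral>\<^sup>+v\<in>{v::'a. R < norm v}. ennreal (japanese v powr k * maxwellian v) \<partial>lborel)
      \<le> ennreal ((c * G + 1) * exp (- R\<^sup>2 / 4))" if R: "0 \<le> R" for R
  proof -
    have pt: "japanese v powr k * maxwellian v
        \<le> c * exp (- R\<^sup>2 / 4) * (japanese v powr k * exp (- (norm v)\<^sup>2 / 4))"
      if "R < norm v" for v :: 'a
    proof -
      have "R\<^sup>2 \<le> (norm v)\<^sup>2"
        using that R by (intro power_mono) auto
      then have "exp (- (norm v)\<^sup>2 / 2) \<le> exp (- R\<^sup>2 / 4) * exp (- (norm v)\<^sup>2 / 4)"
        by (simp flip: exp_add)
      then have "japanese v powr k * c * exp (- (norm v)\<^sup>2 / 2)
         \<le> japanese v powr k * c * (exp (- R\<^sup>2 / 4) * exp (- (norm v)\<^sup>2 / 4))"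
        using c by (intro mult_left_mono) auto
      then show ?thesis
        by (simp add: maxwellian_def c_def mult_ac)
    qed
    have "(\<integral>\<^sup>+v\<in>{v::'a. R < norm v}. ennreal (japanese v powr k * maxwellian v) \<partial>lborel)
       \<le> (\<integral>\<^sup>+(v::'a). ennreal (c * exp (- R\<^sup>2 / 4))
             * ennreal (japanese v powr k * exp (- (norm v)\<^sup>2 / 4)) \<partial>lborel)"
      using c pt by (intro nn_integral_mono)
        (auto simp: indicator_def simp flip: ennreal_mult intro!: ennreal_leI)
    also have "\<dots> = ennreal (c * exp (- R\<^sup>2 / 4)) * I"
      unfolding I_def by (intro nn_integral_cmult) auto
    also have "\<dots> = ennreal (c * exp (- R\<^sup>2 / 4) * G)"
      using c G by (simp add: ennreal_mult)
    also have "\<dots> \<le> ennreal ((c * G + 1) * exp (- R\<^sup>2 / 4))"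
      by (intro ennreal_leI) (simp add: algebra_simps)
    finally show ?thesis .
  qed
  moreover have "0 < c * G + 1" using c G by (simp add: add_nonneg_pos)
  ultimately show ?thesis by (rule that[rotated])
qed

text \<open>
  Since the angular kernel has unit mass, the integral below is the collision frequency. With
  \<open>\<rho> = max 1 (norm v)\<close>, the kernel is at most \<open>(\<rho> / 2) powr \<gamma>\<close> away from the ball of radius
  \<open>\<rho> / 2\<close> around \<open>v\<close>, where the total mass of the Maxwellian suffices. Inside that ball \<open>w\<close> is far
  from the origin whenever \<open>v\<close> is, and the smallness of the Maxwellian there beats the factor
  \<open>\<rho> powr d\<close> contributed by the singular kernel. Hence the frequency decays like
  \<open>norm v powr \<gamma>\<close> and stays bounded near the origin.
\<close>

lemma collision_frequency_le:
  assumes "- real DIM('a::euclidean_space) < \<gamma>" "\<gamma> < 0"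
  obtains \<Lambda> where "0 < \<Lambda>"
    "\<And>v::'a. (\<integral>\<^sup>+w. ennreal (norm (v - w) powr \<gamma> * maxwellian w) \<partial>lborel)
       \<le> ennreal (\<Lambda> * max 1 (norm v) powr \<gamma>)"
proof -
  let ?d = "DIM('a)"
  define c where "c = (2 * pi) powr (- real ?d / 2)"
  have c: "0 \<le> c" by (simp add: c_def)
  obtain C where C: "0 \<le> C" "\<And>(v::'a) r. 0 < r \<Longrightarrow>
       (\<integral>\<^sup>+w\<in>ball v r. ennreal (norm (v - w) powr \<gamma>) \<partial>lborel)
         \<le> ennreal (C * r powr (\<gamma> + real ?d))"
    using nn_integral_norm_powr_ball_le[OF assms] by metis
  define I where "I = (\<integral>\<^sup>+(w::'a). ennreal (maxwellian w) \<partial>lborel)"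
  have "I \<le> (\<integral>\<^sup>+(w::'a). ennreal c * ennreal (japanese w powr 0 * exp (- (norm w)\<^sup>2 / 4)) \<partial>lborel)"
    unfolding I_def using c
    by (intro nn_integral_mono)
       (auto simp: maxwellian_def c_def japanese_def add_nonneg_eq_0_iff simp flip: ennreal_mult
             intro!: ennreal_leI mult_left_mono)
  also have "\<dots> = ennreal c * (\<integral>\<^sup>+(w::'a). ennreal (japanese w powr 0 * exp (- (norm w)\<^sup>2 / 4)) \<partial>lborel)"
    by (intro nn_integral_cmult) auto
  also have "\<dots> < \<infinity>"
    using nn_integral_japanese_gaussian_finite[of 0, where 'a = 'a]
    by (simp add: ennreal_mult_less_top)
  finally obtain G where G: "I = ennreal G" "0 \<le> G"
    by (cases I) auto
  define B where "B = c * exp (1/8) * C * (fact ?d * exp 3)"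
  have B: "0 \<le> B" using c C by (simp add: B_def)
  define \<Lambda> where "\<Lambda> = 2 powr (- \<gamma>) * (G + B) + 1"
  have "0 < \<Lambda>" using G B by (simp add: \<Lambda>_def add_nonneg_pos)
  moreover have "(\<integral>\<^sup>+w. ennreal (norm (v - w) powr \<gamma> * maxwellian w) \<partial>lborel)
       \<le> ennreal (\<Lambda> * max 1 (norm v) powr \<gamma>)" for v :: 'a
  proof -
    define \<rho> where "\<rho> = max 1 (norm v)"
    have \<rho>: "1 \<le> \<rho>" "norm v \<le> \<rho>" by (auto simp: \<rho>_def)
    \<comment> \<open>\<open>D\<close> bounds the Maxwellian on \<open>ball v (\<rho> / 2)\<close>; the factor \<open>exp (1/8)\<close> makes this
      true also when \<open>norm v < 1\<close>, where nothing better than \<open>0 \<le> norm w\<close> is known.\<close>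
    define D where "D = c * exp (1/8) * exp (- \<rho>\<^sup>2 / 8)"
    have D: "0 \<le> D" using c by (simp add: D_def)
    have pt: "ennreal (norm (v - w) powr \<gamma> * maxwellian w)
      \<le> ennreal ((\<rho> / 2) powr \<gamma>) * ennreal (maxwellian w)
        + ennreal D * (ennreal (norm (v - w) powr \<gamma>) * indicator (ball v (\<rho> / 2)) w)" for w
    proof (cases "w \<in> ball v (\<rho> / 2)")
      case True
      then have vw: "norm (v - w) < \<rho> / 2" by (simp add: dist_norm)
      have "\<rho>\<^sup>2 - 1 \<le> 4 * (norm w)\<^sup>2"
      proof (cases "1 \<le> norm v")
        case True
        then have "\<rho> / 2 \<le> norm w"
          using vw norm_triangle_ineq2[of v w] by (simp add: \<rho>_def)
        then have "(\<rho> / 2)\<^sup>2 \<le> (norm w)\<^sup>2" using \<rho> by (intro power_mono) auto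
        then show ?thesis by (simp add: power_divide)
      next
        case False
        then show ?thesis by (simp add: \<rho>_def)
      qed
      then have "exp (- (norm w)\<^sup>2 / 2) \<le> exp (1/8) * exp (- \<rho>\<^sup>2 / 8)"
        by (simp flip: exp_add)
      then have "maxwellian w \<le> D"
        using c by (auto simp: maxwellian_def D_def c_def mult.assoc intro!: mult_left_mono)
      then have "norm (v - w) powr \<gamma> * maxwellian w \<le> D * norm (v - w) powr \<gamma>"
        by (metis mult.commute mult_right_mono powr_ge_zero)
      then have "ennreal (norm (v - w) powr \<gamma> * maxwellian w)
          \<le> ennreal D * (ennreal (norm (v - w) powr \<gamma>) * indicator (ball v (\<rho> / 2)) w)"
        using True D by (auto simp flip: ennreal_mult intro!: ennreal_leI)
      then show ?thesis by (rule order_trans) simp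
    next
      case False
      then have "\<rho> / 2 \<le> norm (v - w)" by (simp add: dist_norm)
      then have "norm (v - w) powr \<gamma> \<le> (\<rho> / 2) powr \<gamma>"
        using \<rho> assms by (intro powr_mono2') auto
      then have "ennreal (norm (v - w) powr \<gamma> * maxwellian w)
          \<le> ennreal ((\<rho> / 2) powr \<gamma>) * ennreal (maxwellian w)"
        by (auto simp flip: ennreal_mult simp: maxwellian_nonneg
                 intro!: ennreal_leI mult_right_mono)
      then show ?thesis by (rule order_trans) simp
    qed
    have meas: "(\<lambda>w. ennreal (norm (v - w) powr \<gamma>) * indicator (ball v (\<rho> / 2)) w) \<in> borel_measurable borel"
      by (intro borel_measurable_times_ennreal borel_measurable_indicator) auto
    have "(\<integral>\<^sup>+w. ennreal (norm (v - w) powr \<gamma> * maxwellian w) \<partial>lborel)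
      \<le> (\<integral>\<^sup>+w. ennreal ((\<rho> / 2) powr \<gamma>) * ennreal (maxwellian w)
        + ennreal D * (ennreal (norm (v - w) powr \<gamma>) * indicator (ball v (\<rho> / 2)) w) \<partial>lborel)"
      by (intro nn_integral_mono pt)
    also have "\<dots> = ennreal ((\<rho> / 2) powr \<gamma>) * I
        + ennreal D * (\<integral>\<^sup>+w\<in>ball v (\<rho> / 2). ennreal (norm (v - w) powr \<gamma>) \<partial>lborel)"
      unfolding I_def
      by (subst nn_integral_add) (simp_all add: nn_integral_cmult meas borel_measurable_times_ennreal)
    also have "\<dots> \<le> ennreal ((\<rho> / 2) powr \<gamma>) * ennreal G
        + ennreal D * ennreal (C * (\<rho> / 2) powr (\<gamma> + real ?d))"
      using \<rho> unfolding G by (intro add_mono mult_left_mono C) auto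
    also have "\<dots> = ennreal ((\<rho> / 2) powr \<gamma> * G + D * (C * (\<rho> / 2) powr (\<gamma> + real ?d)))"
      using C D G by (simp add: ennreal_mult)
    also have "\<dots> \<le> ennreal (\<Lambda> * \<rho> powr \<gamma>)"
    proof (intro ennreal_leI)
      have "(\<rho> / 2) powr (\<gamma> + real ?d) = (\<rho> / 2) powr \<gamma> * (\<rho> / 2) ^ ?d"
        using \<rho> by (simp add: powr_add powr_realpow)
      also have "\<dots> \<le> (\<rho> / 2) powr \<gamma> * (1 + \<rho>) ^ ?d"
        using \<rho> by (intro mult_left_mono power_mono) auto
      finally have "D * (C * (\<rho> / 2) powr (\<gamma> + real ?d))
          \<le> D * (C * ((\<rho> / 2) powr \<gamma> * (1 + \<rho>) ^ ?d))"
        using C D by (intro mult_left_mono) auto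
      also have "\<dots> = c * exp (1/8) * C * (\<rho> / 2) powr \<gamma> * ((1 + \<rho>) ^ ?d * exp (- \<rho>\<^sup>2 / 8))"
        by (simp add: D_def)
      also have "\<dots> \<le> c * exp (1/8) * C * (\<rho> / 2) powr \<gamma> * (fact ?d * exp 3)"
        using c C \<rho> by (intro mult_left_mono power_mult_gaussian_le) auto
      also have "\<dots> = (\<rho> / 2) powr \<gamma> * B"
        by (simp add: B_def)
      finally have "(\<rho> / 2) powr \<gamma> * G + D * (C * (\<rho> / 2) powr (\<gamma> + real ?d))
          \<le> (\<rho> / 2) powr \<gamma> * (G + B)"
        by (simp add: algebra_simps)
      also have "\<dots> = \<rho> powr \<gamma> * (2 powr (- \<gamma>) * (G + B))"
        using \<rho> by (simp add: powr_divide powr_minus_divide)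
      also have "\<dots> \<le> \<Lambda> * \<rho> powr \<gamma>"
        by (simp add: \<Lambda>_def algebra_simps)
      finally show "(\<rho> / 2) powr \<gamma> * G + D * (C * (\<rho> / 2) powr (\<gamma> + real ?d)) \<le> \<Lambda> * \<rho> powr \<gamma>" .
    qed
    finally show ?thesis by (simp add: \<rho>_def)
  qed
  ultimately show ?thesis by (rule that)
qed

section \<open>The loss term\<close>

lemma finite_measure_sphere_measure:
  "finite_measure (sphere_measure :: 'a::euclidean_space measure)"
proof
  have "emeasure lborel {x \<in> ball 0 1 - {0::'a}. x /\<^sub>R norm x \<in> sphere 0 1}
      \<le> emeasure lborel (ball (0::'a) 1)"
    by (intro emeasure_mono) auto
  also have "\<dots> < \<infinity>" by (simp add: emeasure_ball)
  finally show "emeasure (sphere_measure :: 'a measure) (space sphere_measure) \<noteq> \<infinity>"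
    by (simp add: emeasure_sphere_measure ennreal_mult_eq_top_iff)
qed

text \<open>
  The gain term is non-negative, so only the loss term can make \<open>boltzmann_L\<close> negative, and by Fubini
  its integral is \<open>f v\<close> times the collision frequency. The estimate holds at every \<open>v\<close>: where the
  integrand is not integrable, the operator takes the value \<open>0\<close>, and the left-hand side is not
  positive.
\<close>

lemma boltzmann_L_ge:
  fixes f :: "'a::euclidean_space \<Rightarrow> real"
  assumes b_measurable [measurable]: "b \<in> borel_measurable (restrict_space borel {-1..1})"
    and b_nonneg: "\<And>x. x \<in> {-1..1} \<Longrightarrow> 0 \<le> b x"
    and b_norm: "\<And>e::'a. norm e = 1 \<Longrightarrow>
                   (\<integral>\<^sup>+\<sigma>. ennreal (b (e \<bullet> \<sigma>)) \<partial>sphere_measure) = 1"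
    and freq: "(\<integral>\<^sup>+w. ennreal (norm (v - w) powr \<gamma> * maxwellian w) \<partial>lborel) \<le> ennreal s"
    and s: "0 \<le> s"
    and f: "\<And>x. 0 \<le> f x"
  shows "- s * f v \<le> boltzmann_L \<gamma> b f v"
proof -
  let ?P = "lborel \<Otimes>\<^sub>M (sphere_measure :: 'a measure)"
  interpret sphere: finite_measure "sphere_measure :: 'a measure"
    by (rule finite_measure_sphere_measure)
  define F where "F p = norm (v - fst p) powr \<gamma> * b (cos_dev v (fst p) (snd p)) *
        (f (post_v v (fst p) (snd p)) * maxwellian (post_w v (fst p) (snd p)) - f v * maxwellian (fst p))"
    for p :: "'a \<times> 'a"
  define H where "H p = norm (v - fst p) powr \<gamma> * b (cos_dev v (fst p) (snd p)) * (f v * maxwellian (fst p))"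
    for p :: "'a \<times> 'a"
  have L: "boltzmann_L \<gamma> b f v = integral\<^sup>L ?P F"
    unfolding boltzmann_L_def F_def by (simp add: case_prod_beta')
  have cos: "cos_dev v w \<sigma> \<in> {-1..1}" if "norm \<sigma> = 1" for w \<sigma> :: 'a
  proof -
    have "norm ((v - w) /\<^sub>R norm (v - w)) \<le> 1" by (cases "v = w") auto
    then have "\<bar>cos_dev v w \<sigma>\<bar> \<le> 1"
      unfolding cos_dev_def
      using Cauchy_Schwarz_ineq2[of "(v - w) /\<^sub>R norm (v - w)" \<sigma>] that by simp
    then show ?thesis by auto
  qed
  have b0: "0 \<le> b (cos_dev v (fst p) (snd p))" if "p \<in> space ?P" for p
    using that by (intro b_nonneg cos) (auto simp: space_pair_measure)
  have id_meas: "(\<lambda>\<sigma>::'a. \<sigma>) \<in> sphere_measure \<rightarrow>\<^sub>M borel"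
    by (subst measurable_cong_sets[OF sets_sphere_measure refl]) (intro measurable_restrict_space1, simp)
  have snd_meas [measurable]: "snd \<in> ?P \<rightarrow>\<^sub>M borel"
    by (rule measurable_compose[OF measurable_snd id_meas])
  have fst_meas [measurable]: "fst \<in> ?P \<rightarrow>\<^sub>M borel"
    using measurable_fst[of lborel] by (simp add: measurable_lborel2)
  have cos_meas: "(\<lambda>p. cos_dev v (fst p) (snd p)) \<in> ?P \<rightarrow>\<^sub>M restrict_space borel {-1..1}"
  proof (intro measurable_restrict_space2 funcsetI)
    show "cos_dev v (fst p) (snd p) \<in> {-1..1}" if "p \<in> space ?P" for p
      using that by (intro cos) (auto simp: space_pair_measure)
    show "(\<lambda>p. cos_dev v (fst p) (snd p)) \<in> borel_measurable ?P"
      unfolding cos_dev_def by measurable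
  qed
  have b_meas [measurable]: "(\<lambda>p. b (cos_dev v (fst p) (snd p))) \<in> borel_measurable ?P"
    by (rule measurable_compose[OF cos_meas b_measurable])
  have H_meas [measurable]: "H \<in> borel_measurable ?P"
    unfolding H_def maxwellian_def by measurable
  have H0: "0 \<le> H p" if "p \<in> space ?P" for p
    using b0[OF that] f by (simp add: H_def maxwellian_def)
  have inner: "(\<integral>\<^sup>+\<sigma>. ennreal (H (w, \<sigma>)) \<partial>sphere_measure)
      = ennreal (f v) * ennreal (norm (v - w) powr \<gamma> * maxwellian w)" for w
  proof (cases "v = w")
    case False
    define e where "e = (v - w) /\<^sub>R norm (v - w)"
    have e: "norm e = 1" using False by (simp add: e_def)
    have "(\<lambda>\<sigma>. b (cos_dev v (fst (w, \<sigma>)) (snd (w, \<sigma>)))) \<in> borel_measurable sphere_measure"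
      by (rule measurable_compose[OF measurable_Pair1' b_meas]) simp
    then have m: "(\<lambda>\<sigma>. b (e \<bullet> \<sigma>)) \<in> borel_measurable sphere_measure"
      by (simp add: cos_dev_def e_def)
    define K where "K = f v * (norm (v - w) powr \<gamma> * maxwellian w)"
    have K: "0 \<le> K" using f by (simp add: K_def maxwellian_def)
    have "H (w, \<sigma>) = K * b (e \<bullet> \<sigma>)" for \<sigma>
      by (simp add: H_def K_def cos_dev_def e_def)
    then have "(\<integral>\<^sup>+\<sigma>. ennreal (H (w, \<sigma>)) \<partial>sphere_measure)
        = (\<integral>\<^sup>+\<sigma>. ennreal K * ennreal (b (e \<bullet> \<sigma>)) \<partial>sphere_measure)"
      using K by (simp add: ennreal_mult')
    also have "\<dots> = ennreal K"
      using m by (subst nn_integral_cmult) (auto simp: b_norm[OF e])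
    finally show ?thesis
      using f by (simp add: K_def ennreal_mult')
  qed (simp add: H_def)
  have "(\<integral>\<^sup>+p. ennreal (H p) \<partial>?P) = (\<integral>\<^sup>+w. \<integral>\<^sup>+\<sigma>. ennreal (H (w, \<sigma>)) \<partial>sphere_measure \<partial>lborel)"
    by (intro sphere.nn_integral_fst[symmetric]) measurable
  also have "\<dots> = ennreal (f v) * (\<integral>\<^sup>+w. ennreal (norm (v - w) powr \<gamma> * maxwellian w) \<partial>lborel)"
    unfolding inner by (intro nn_integral_cmult) (simp add: maxwellian_def)
  also have "\<dots> \<le> ennreal (f v) * ennreal s"
    by (intro mult_left_mono freq) auto
  also have "\<dots> = ennreal (s * f v)"
    using f s by (simp add: ennreal_mult mult.commute)
  finally have H_le: "(\<integral>\<^sup>+p. ennreal (H p) \<partial>?P) \<le> ennreal (s * f v)" .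
  show ?thesis
  proof (cases "integrable ?P F")
    case True
    have AE0: "AE p in ?P. 0 \<le> H p" using H0 by (intro AE_I2)
    have H_int: "integrable ?P H"
      using AE0 H_le ennreal_less_top by (intro integrableI_nonneg) (auto intro: le_less_trans)
    have "- integral\<^sup>L ?P F = (\<integral>p. - F p \<partial>?P)"
      by simp
    also have "\<dots> \<le> integral\<^sup>L ?P H"
    proof (intro integral_mono)
      show "integrable ?P (\<lambda>p. - F p)" using True by simp
      show "- F p \<le> H p" if p: "p \<in> space ?P" for p
        using b0[OF p] f
        by (auto simp: F_def H_def maxwellian_def right_diff_distrib intro!: mult_nonneg_nonneg)
    qed (fact H_int)
    also have "\<dots> = enn2real (\<integral>\<^sup>+p. ennreal (H p) \<partial>?P)"
      by (intro integral_eq_nn_integral AE0) auto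
    also have "\<dots> \<le> s * f v"
      using H_le f s by (intro enn2real_leI) auto
    finally show ?thesis by (simp add: L)
  next
    case False
    then show ?thesis
      using f s by (simp add: L not_integrable_integral_eq)
  qed
qed

section \<open>Comparison for positive semigroups on the space of integrable functions\<close>

text \<open>
  Only right difference quotients are controlled, so the mean value theorem does not apply. The set of
  times up to which \<open>m r \<le> m 0 + \<epsilon> * r\<close> holds is an interval containing \<open>0\<close>. The hypothesis on
  \<open>\<delta>\<close>, a one-sided form of left continuity, shows that this interval contains its supremum, and the
  slope condition moves past any supremum smaller than \<open>T\<close>.
\<close>

lemma nonincreasing_if_right_slope_le_0:
  fixes m \<delta> :: "real \<Rightarrow> real"
  assumes slope: "\<And>t \<epsilon>. 0 \<le> t \<Longrightarrow> 0 < \<epsilon> \<Longrightarrow> \<forall>\<^sub>F h in at_right 0. m (t + h) \<le> m t + \<epsilon> * h"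
    and jump: "\<And>s t. 0 \<le> s \<Longrightarrow> s \<le> t \<Longrightarrow> m t \<le> m s + \<delta> (t - s)"
    and \<delta>: "(\<delta> \<longlongrightarrow> 0) (at_right 0)"
    and T: "0 \<le> T"
  shows "m T \<le> m 0"
proof (rule field_le_epsilon)
  fix e :: real
  assume e: "0 < e"
  define \<epsilon> where "\<epsilon> = e / (T + 1)"
  have \<epsilon>: "0 < \<epsilon>" "\<epsilon> * T \<le> e"
    using e T by (auto simp: \<epsilon>_def field_simps)
  define A where "A = {s \<in> {0..T}. \<forall>r\<in>{0..s}. m r \<le> m 0 + \<epsilon> * r}"
  define c where "c = Sup A"
  have A0: "0 \<in> A" using T by (auto simp: A_def)
  have bdd: "bdd_above A" by (rule bdd_aboveI[of _ T]) (auto simp: A_def)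
  have c: "0 \<le> c" "c \<le> T"
    using A0 bdd T by (auto simp: c_def A_def intro!: cSup_upper cSup_least)
  have below: "m r \<le> m 0 + \<epsilon> * r" if r: "0 \<le> r" "r < c" for r
  proof -
    obtain s where "s \<in> A" "r < s"
      using r A0 bdd less_cSup_iff[of A r] unfolding c_def by blast
    then show ?thesis using r by (auto simp: A_def)
  qed
  have at_c: "m c \<le> m 0 + \<epsilon> * c"
  proof (cases "c = 0")
    case False
    with c have c0: "0 < c" by simp
    have "\<forall>\<^sub>F h in at_right 0. m c \<le> m 0 + \<epsilon> * c + \<delta> h"
    proof -
      have "\<forall>\<^sub>F h in at_right 0. h \<in> {0<..<c}"
        using c0 by (rule eventually_at_right_real)
      then show ?thesis
      proof eventually_elim
        case (elim h)
        have "m c \<le> m (c - h) + \<delta> h"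
          using jump[of "c - h" c] elim by simp
        also have "m (c - h) \<le> m 0 + \<epsilon> * (c - h)"
          using elim by (intro below) auto
        also have "\<epsilon> * (c - h) \<le> \<epsilon> * c"
          using elim \<epsilon> by (intro mult_left_mono) auto
        finally show ?case by simp
      qed
    qed
    moreover have "((\<lambda>h. m 0 + \<epsilon> * c + \<delta> h) \<longlongrightarrow> m 0 + \<epsilon> * c + 0) (at_right 0)"
      by (intro tendsto_intros \<delta>)
    ultimately show ?thesis
      using tendsto_lowerbound[of "\<lambda>h. m 0 + \<epsilon> * c + \<delta> h" "m 0 + \<epsilon> * c + 0" "at_right 0" "m c"]
      by simp
  qed simp
  have "c = T"
  proof (rule ccontr)
    assume "c \<noteq> T"
    with c have cT: "c < T" by simp
    obtain \<eta> where \<eta>: "0 < \<eta>" "\<And>h. 0 < h \<Longrightarrow> h < \<eta> \<Longrightarrow> m (c + h) \<le> m c + \<epsilon> * h"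
      using slope[OF c(1) \<epsilon>(1)] unfolding eventually_at_right_field by auto
    define s where "s = c + min (\<eta> / 2) (T - c)"
    have s: "c < s" "s \<le> T" "s < c + \<eta>"
      using \<eta> cT by (auto simp: s_def min_def)
    have "m r \<le> m 0 + \<epsilon> * r" if r: "r \<in> {0..s}" for r
    proof (cases r c rule: linorder_cases)
      case greater
      then have "m r \<le> m c + \<epsilon> * (r - c)"
        using \<eta>(2)[of "r - c"] r s by simp
      then show ?thesis using at_c by (simp add: algebra_simps)
    qed (use r below at_c in auto)
    then have "s \<in> A" using s c by (auto simp: A_def)
    then have "s \<le> c" unfolding c_def using bdd by (rule cSup_upper)
    then show False using s by simp
  qed
  then show "m T \<le> m 0 + e" using at_c \<epsilon> by simp
qed

lemma L1_norm_eq_0_iff: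
  assumes "integrable lborel f"
  shows "L1_norm f = 0 \<longleftrightarrow> (AE v in lborel. f v = 0)"
  using assms unfolding L1_norm_def
  by (subst integral_nonneg_eq_0_iff_AE) auto

lemma L1_bounded_linear_diff:
  assumes T: "L1_bounded_linear T" and f: "integrable lborel f" and g: "integrable lborel g"
  shows "AE v in lborel. T (\<lambda>x. f x - g x) v = T f v - T g v"
proof -
  have "AE v in lborel. T (\<lambda>x. f x + (- 1) * g x) v = T f v + T (\<lambda>x. (- 1) * g x) v"
    using T f g unfolding L1_bounded_linear_def by (metis integrable_mult_right)
  moreover have "AE v in lborel. T (\<lambda>x. (- 1) * g x) v = (- 1) * T g v"
    using T g unfolding L1_bounded_linear_def by metis
  ultimately show ?thesis by eventually_elim simp
qed

lemma L1_bounded_linear_cong_AE: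
  assumes T: "L1_bounded_linear T" and f: "integrable lborel f" and g: "integrable lborel g"
    and eq: "AE v in lborel. f v = g v"
  shows "AE v in lborel. T f v = T g v"
proof -
  have fg: "integrable lborel (\<lambda>x. f x - g x)" using f g by simp
  obtain K where K: "\<And>h. integrable lborel h \<Longrightarrow> L1_norm (T h) \<le> K * L1_norm h"
    using T unfolding L1_bounded_linear_def by metis
  have "L1_norm (\<lambda>x. f x - g x) = 0"
    using eq by (subst L1_norm_eq_0_iff[OF fg]) auto
  then have "L1_norm (T (\<lambda>x. f x - g x)) \<le> 0"
    using K[OF fg] by simp
  moreover have "0 \<le> L1_norm (T (\<lambda>x. f x - g x))" by (simp add: L1_norm_def)
  moreover have "integrable lborel (T (\<lambda>x. f x - g x))"
    using T fg unfolding L1_bounded_linear_def by metis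
  ultimately have "AE v in lborel. T (\<lambda>x. f x - g x) v = 0"
    using L1_norm_eq_0_iff[of "T (\<lambda>x. f x - g x)"] by linarith
  with L1_bounded_linear_diff[OF T f g] show ?thesis
    by eventually_elim simp
qed

text \<open>
  A positive mass-preserving map sends the positive and the negative part of \<open>f\<close> to non-negative
  functions of the same mass. The resulting contraction turns strong continuity at time \<open>0\<close> into left
  continuity of every orbit.
\<close>

lemma L1_norm_semigroup_le:
  assumes semigroup: "L1_C0_semigroup U"
    and positive: "L1_positive U" and mass_preserving: "L1_mass_preserving U"
    and t: "0 \<le> t" and f: "integrable lborel f"
  shows "L1_norm (U t f) \<le> L1_norm f"
proof -
  have T: "L1_bounded_linear (U t)"
    using semigroup t unfolding L1_C0_semigroup_def by blast
  have int: "integrable lborel (U t g)" if "integrable lborel g" for g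
    using T that unfolding L1_bounded_linear_def by blast
  define p where "p x = max 0 (f x)" for x
  define n where "n x = max 0 (- f x)" for x
  have p: "integrable lborel p" and n: "integrable lborel n"
    using f by (simp_all add: p_def[abs_def] n_def[abs_def])
  have "AE v in lborel. 0 \<le> U t p v" "AE v in lborel. 0 \<le> U t n v"
    using positive t p n unfolding L1_positive_def by (auto simp: p_def n_def)
  moreover have "AE v in lborel. U t f v = U t p v - U t n v"
  proof -
    have "(\<lambda>x. p x - n x) = f" by (auto simp: p_def n_def)
    then show ?thesis using L1_bounded_linear_diff[OF T p n] by simp
  qed
  ultimately have "AE v in lborel. \<bar>U t f v\<bar> \<le> U t p v + U t n v"
    by eventually_elim simp
  then have "L1_norm (U t f) \<le> (\<integral>v. U t p v + U t n v \<partial>lborel)"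
    unfolding L1_norm_def using int f p n by (intro integral_mono_AE) auto
  also have "\<dots> = (\<integral>v. p v \<partial>lborel) + (\<integral>v. n v \<partial>lborel)"
    using mass_preserving t p n int unfolding L1_mass_preserving_def by simp
  also have "\<dots> = (\<integral>v. p v + n v \<partial>lborel)"
    using p n by simp
  also have "(\<lambda>v. p v + n v) = (\<lambda>v. \<bar>f v\<bar>)"
    by (auto simp: p_def n_def)
  finally show ?thesis by (simp add: L1_norm_def)
qed

text \<open>
  A comparison principle, replacing Duhamel's formula. Let \<open>m t\<close> be the mass by which \<open>U t f0\<close> fails
  to lie above \<open>exp (- t * a) * f0\<close>. Restarting at time \<open>t\<close> from \<open>f = U t f0\<close>, the old deficit is
  multiplied by \<open>exp (- h * a) \<le> 1\<close>, and the new one is at most that of \<open>U h f\<close> below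
  \<open>exp (- h * a) * f\<close>. Because \<open>U h f = f + h * A f + o(h)\<close> in the mean and \<open>A f \<ge> - a * f\<close>, the new
  deficit is \<open>o(h)\<close>. This \<open>o(h)\<close> is not uniform in \<open>t\<close>, so that the increments cannot simply be
  added up, but \<open>m\<close> has non-positive right slope at each time and therefore does not increase from
  its initial value \<open>0\<close>.
\<close>

lemma semigroup_ge_exp:
  fixes U :: "real \<Rightarrow> ('a::euclidean_space \<Rightarrow> real) \<Rightarrow> 'a \<Rightarrow> real"
  assumes semigroup: "L1_C0_semigroup U" and generator: "L1_generates A U"
    and positive: "L1_positive U" and mass_preserving: "L1_mass_preserving U"
    and a_meas [measurable]: "a \<in> borel_measurable borel"
    and a: "\<And>v. 0 \<le> a v" "\<And>v. a v \<le> \<Lambda>"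
    and A_ge: "\<And>f v. integrable lborel f \<Longrightarrow> (\<And>x. 0 \<le> f x) \<Longrightarrow> - a v * f v \<le> A f v"
    and f0: "integrable lborel f0" "AE v in lborel. 0 \<le> f0 v" and T: "0 \<le> T"
  shows "AE v in lborel. exp (- T * a v) * f0 v \<le> U T f0 v"
proof -
  have lin: "L1_bounded_linear (U t)" if "0 \<le> t" for t
    using semigroup that unfolding L1_C0_semigroup_def by blast
  have int: "integrable lborel (U t g)" if "0 \<le> t" "integrable lborel g" for t g
    using lin that unfolding L1_bounded_linear_def by blast
  have add: "AE v in lborel. U (s + t) g v = U s (U t g) v"
    if "0 \<le> s" "0 \<le> t" "integrable lborel g" for s t g
    using semigroup that unfolding L1_C0_semigroup_def by blast
  define D where "D t v = max 0 (exp (- t * a v) * f0 v - U t f0 v)" for t v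
  define m where "m t = (\<integral>v. D t v \<partial>lborel)" for t
  have exp_int: "integrable lborel (\<lambda>v. exp (- t * a v) * f0 v)" if "0 \<le> t" for t
  proof (rule Bochner_Integration.integrable_bound[OF f0(1)])
    show "AE v in lborel. norm (exp (- t * a v) * f0 v) \<le> norm (f0 v)"
      using that a by (auto simp: abs_mult intro!: mult_left_le_one_le)
  qed (use f0 in measurable)
  have D_int: "integrable lborel (D t)" if "0 \<le> t" for t
    unfolding D_def[abs_def] using int[OF that f0(1)] exp_int[OF that] by simp
  have "m T \<le> m 0"
  proof (rule nonincreasing_if_right_slope_le_0[where m = m and \<delta> = "\<lambda>h. L1_norm (\<lambda>v. U h f0 v - f0 v)"])
    show "((\<lambda>h. L1_norm (\<lambda>v. U h f0 v - f0 v)) \<longlongrightarrow> 0) (at_right 0)"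
      using semigroup f0(1) unfolding L1_C0_semigroup_def by blast
  next
    fix s t :: real
    assume st: "0 \<le> s" "s \<le> t"
    define g where "g v = U (t - s) f0 v - f0 v" for v
    have g: "integrable lborel g"
      using int[of "t - s" f0] st f0 by (simp add: g_def[abs_def])
    have "AE v in lborel. U (s + (t - s)) f0 v = U s (U (t - s) f0) v"
      using st f0 by (intro add) auto
    moreover have "AE v in lborel. U s g v = U s (U (t - s) f0) v - U s f0 v"
      unfolding g_def using st f0 by (intro L1_bounded_linear_diff lin int) auto
    ultimately have "AE v in lborel. D t v \<le> D s v + \<bar>U s g v\<bar>"
      using f0(2)
    proof eventually_elim
      case (elim v)
      have "exp (- t * a v) * f0 v \<le> exp (- s * a v) * f0 v"
        using st a elim by (intro mult_right_mono) (auto intro: mult_right_mono)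
      then show ?case using elim by (simp add: D_def)
    qed
    then have "m t \<le> (\<integral>v. D s v + \<bar>U s g v\<bar> \<partial>lborel)"
      unfolding m_def using st D_int int[OF st(1) g] by (intro integral_mono_AE) auto
    also have "\<dots> = m s + L1_norm (U s g)"
      unfolding m_def L1_norm_def using st D_int int[OF st(1) g] by simp
    also have "\<dots> \<le> m s + L1_norm g"
      using L1_norm_semigroup_le[OF semigroup positive mass_preserving st(1) g] by simp
    finally show "m t \<le> m s + L1_norm (\<lambda>v. U (t - s) f0 v - f0 v)"
      by (simp add: g_def[abs_def])
  next
    fix t \<epsilon> :: real
    assume t: "0 \<le> t" and \<epsilon>: "0 < \<epsilon>"
    \<comment> \<open>Positivity of \<open>U\<close> holds almost everywhere only. The bound on \<open>A\<close> needs it everywhere,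
      because \<open>A f v\<close> may depend on values of \<open>f\<close> away from \<open>v\<close>.\<close>
    define f where "f v = max 0 (U t f0 v)" for v
    have f: "integrable lborel f" using int[OF t f0(1)] by (simp add: f_def[abs_def])
    have f_eq: "AE v in lborel. U t f0 v = f v"
    proof -
      have "AE v in lborel. 0 \<le> U t f0 v"
        using positive t f0 unfolding L1_positive_def by blast
      then show ?thesis by eventually_elim (simp add: f_def)
    qed
    have Af: "integrable lborel (A f)"
      and lim: "((\<lambda>h. L1_norm (\<lambda>v. (U h f v - f v) / h - A f v)) \<longlongrightarrow> 0) (at_right 0)"
      using generator f unfolding L1_generates_def by blast+
    define q where "q h v = (U h f v - f v) / h - A f v" for h v
    define c where "c = \<Lambda>\<^sup>2 * L1_norm f"
    have le: "m (t + h) \<le> m t + h * (L1_norm (q h) + h * c)" if h: "0 < h" for h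
    proof -
      have q: "integrable lborel (q h)"
        unfolding q_def[abs_def] using Af f int[of h f] h by simp
      have "AE v in lborel. U (h + t) f0 v = U h (U t f0) v"
        using h t f0 by (intro add) auto
      moreover have "AE v in lborel. U h (U t f0) v = U h f v"
        using h t f0 by (intro L1_bounded_linear_cong_AE[OF lin int[OF t f0(1)] f f_eq]) auto
      ultimately have "AE v in lborel. D (t + h) v \<le> D t v + (h * \<bar>q h v\<bar> + h\<^sup>2 * \<Lambda>\<^sup>2 * f v)"
        using f_eq
      proof eventually_elim
        case (elim v)
        define x where "x = h * a v"
        have x: "0 \<le> x" "x \<le> h * \<Lambda>" using h a by (auto simp: x_def)
        have fv: "0 \<le> f v" by (simp add: f_def)
        have "1 \<le> (1 - x + x\<^sup>2) * (1 + x)"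
          using x by (simp add: algebra_simps power2_eq_square)
        also have "\<dots> \<le> (1 - x + x\<^sup>2) * exp x"
          using zero_le_power2[of "x - 1"] x
          by (intro mult_left_mono exp_ge_add_one_self) (simp add: power2_eq_square algebra_simps)
        finally have "exp (- x) \<le> 1 - x + x\<^sup>2"
          by (simp add: exp_minus field_simps)
        also have "\<dots> \<le> 1 - x + h\<^sup>2 * \<Lambda>\<^sup>2"
          using power_mono[OF x(2,1), of 2] by (simp add: power_mult_distrib)
        finally have "exp (- x) * f v \<le> (1 - x + h\<^sup>2 * \<Lambda>\<^sup>2) * f v"
          using fv by (rule mult_right_mono)
        moreover have "U h f v = f v + h * (q h v + A f v)"
          using h by (simp add: q_def)
        moreover have "h * (- a v * f v) \<le> h * A f v"
          using h A_ge[OF f] by (intro mult_left_mono) (auto simp: f_def)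
        moreover have "- (h * q h v) \<le> h * \<bar>q h v\<bar>"
          using h by (metis abs_ge_minus_self abs_mult abs_of_pos)
        ultimately have 1: "exp (- x) * f v - U h f v \<le> h * \<bar>q h v\<bar> + h\<^sup>2 * \<Lambda>\<^sup>2 * f v"
          by (simp add: x_def algebra_simps)
        have "exp (- x) * (exp (- t * a v) * f0 v - f v) \<le> exp (- x) * D t v"
          using elim by (intro mult_left_mono) (auto simp: D_def)
        also have "\<dots> \<le> D t v"
          using x by (intro mult_left_le_one_le) (auto simp: D_def)
        finally have 2: "exp (- (t + h) * a v) * f0 v - exp (- x) * f v \<le> D t v"
          by (simp add: x_def algebra_simps exp_add[symmetric] flip: mult.assoc)
        have "0 \<le> h * \<bar>q h v\<bar> + h\<^sup>2 * \<Lambda>\<^sup>2 * f v" "0 \<le> D t v"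
          using h fv by (auto simp: D_def)
        moreover have "U (t + h) f0 v = U h f v"
          using elim by (simp add: add.commute)
        ultimately show ?case
          unfolding D_def[of "t + h"] using 1 2 by (intro max.boundedI) linarith+
      qed
      then have "m (t + h) \<le> (\<integral>v. D t v + (h * \<bar>q h v\<bar> + h\<^sup>2 * \<Lambda>\<^sup>2 * f v) \<partial>lborel)"
        unfolding m_def using h t D_int q f by (intro integral_mono_AE) auto
      also have "\<dots> = m t + (h * L1_norm (q h) + h\<^sup>2 * \<Lambda>\<^sup>2 * (\<integral>v. f v \<partial>lborel))"
        unfolding m_def L1_norm_def using h t D_int q f by simp
      also have "(\<integral>v. f v \<partial>lborel) = L1_norm f"
        by (simp add: L1_norm_def f_def)
      finally show ?thesis
        by (simp add: c_def power2_eq_square algebra_simps)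
    qed
    have "((\<lambda>h. L1_norm (q h) + h * c) \<longlongrightarrow> 0 + 0 * c) (at_right 0)"
      unfolding q_def[abs_def] by (intro tendsto_intros lim)
    then have "\<forall>\<^sub>F h in at_right 0. L1_norm (q h) + h * c < \<epsilon>"
      using \<epsilon> by (intro order_tendstoD) auto
    moreover have "\<forall>\<^sub>F h in at_right (0::real). 0 < h"
      by (rule eventually_at_right_less)
    ultimately show "\<forall>\<^sub>F h in at_right 0. m (t + h) \<le> m t + \<epsilon> * h"
    proof eventually_elim
      case (elim h)
      have "h * (L1_norm (q h) + h * c) \<le> \<epsilon> * h"
        using elim by (subst mult.commute) (intro mult_right_mono, auto)
      then show ?case using le[of h] elim by linarith
    qed
  qed (fact T)
  also have "m 0 = 0"
  proof -
    have "AE v in lborel. U 0 f0 v = f0 v"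
      using semigroup f0(1) unfolding L1_C0_semigroup_def by blast
    then have "AE v in lborel. D 0 v = 0"
      by eventually_elim (simp add: D_def)
    then show ?thesis
      unfolding m_def by (rule integral_eq_zero_AE)
  qed
  finally have "m T \<le> 0" .
  moreover have "0 \<le> m T" unfolding m_def by (simp add: D_def)
  ultimately have "integral\<^sup>L lborel (D T) = 0"
    by (simp only: m_def)
  moreover have "AE v in lborel. 0 \<le> D T v"
    by (simp add: D_def)
  ultimately have "AE v in lborel. D T v = 0"
    using integral_nonneg_eq_0_iff_AE[OF D_int[OF T]] by blast
  then show ?thesis
    by eventually_elim (simp add: D_def max_def split: if_splits)
qed

section \<open>Slow relaxation of the tail\<close>

theorem theoremB1:
  fixes \<gamma> :: real
    and b :: "real \<Rightarrow> real"
    and U :: "real \<Rightarrow> ('a::euclidean_space \<Rightarrow> real) \<Rightarrow> 'a \<Rightarrow> real"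
  assumes dim: "DIM('a) \<ge> 2"
    and gamma: "- real DIM('a) < \<gamma>" "\<gamma> < 0"
    and b_measurable: "b \<in> borel_measurable (restrict_space borel {-1..1})"
    and b_nonneg: "\<And>x. x \<in> {-1..1} \<Longrightarrow> 0 \<le> b x"
    and b_even: "\<And>x. x \<in> {-1..1} \<Longrightarrow> b (- x) = b x"
    and b_norm: "\<And>e::'a. norm e = 1 \<Longrightarrow>
                   (\<integral>\<^sup>+\<sigma>. ennreal (b (e \<bullet> \<sigma>)) \<partial>sphere_measure) = 1"
    and semigroup: "L1_C0_semigroup U"
    and generator: "L1_generates (boltzmann_L \<gamma> b) U"
    and positive: "L1_positive U"
    and mass_preserving: "L1_mass_preserving U"
  shows "\<exists>C1>0. \<forall>k\<ge>0. \<exists>C2>0.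
           \<forall>f0 :: 'a \<Rightarrow> real.
             integrable lborel f0 \<longrightarrow> (AE v in lborel. 0 \<le> f0 v) \<longrightarrow>
             (\<integral>v. f0 v \<partial>lborel) = 1 \<longrightarrow>
             (\<forall>t\<ge>0.
                enn2ereal (wL1_norm k (\<lambda>v. U t f0 v - maxwellian v))
                \<ge> ereal C1 * enn2ereal (\<integral>\<^sup>+v\<in>{v. norm v > t powr (1 / \<bar>\<gamma>\<bar>)}.
                                ennreal (japanese v powr k * f0 v) \<partial>lborel)
                  - ereal (C2 * exp (- (t powr (2 / \<bar>\<gamma>\<bar>)) / 4)))"
proof -
  obtain \<Lambda> where \<Lambda>: "0 < \<Lambda>"
    "\<And>v::'a. (\<integral>\<^sup>+w. ennreal (norm (v - w) powr \<gamma> * maxwellian w) \<partial>lborel)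
       \<le> ennreal (\<Lambda> * max 1 (norm v) powr \<gamma>)"
    using collision_frequency_le[OF gamma] by metis
  define a where "a v = \<Lambda> * max 1 (norm v) powr \<gamma>" for v :: 'a
  have a_meas: "a \<in> borel_measurable borel"
    unfolding a_def[abs_def] by measurable
  have a0: "0 \<le> a v" for v using \<Lambda> by (simp add: a_def)
  have a_le: "a v \<le> \<Lambda>" for v
    using \<Lambda>(1) gamma powr_mono2'[of \<gamma> 1 "max 1 (norm v)"] by (simp add: a_def)
  have L_ge: "- a v * f v \<le> boltzmann_L \<gamma> b f v" if "\<And>x. 0 \<le> f x" for f :: "'a \<Rightarrow> real" and v
    using that a0 \<Lambda>(2)[of v]
    by (intro boltzmann_L_ge[OF b_measurable b_nonneg b_norm]) (auto simp: a_def)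
  show ?thesis
  proof (rule exI[of _ "exp (- \<Lambda>)"], intro conjI allI impI)
    fix k :: real
    assume k: "0 \<le> k"
    obtain K where K: "0 < K"
      "\<And>R. 0 \<le> R \<Longrightarrow> (\<integral>\<^sup>+v\<in>{v::'a. R < norm v}.
         ennreal (japanese v powr k * maxwellian v) \<partial>lborel) \<le> ennreal (K * exp (- R\<^sup>2 / 4))"
      using maxwellian_tail[OF k] by metis
    show "\<exists>C2>0. \<forall>f0 :: 'a \<Rightarrow> real.
             integrable lborel f0 \<longrightarrow> (AE v in lborel. 0 \<le> f0 v) \<longrightarrow>
             (\<integral>v. f0 v \<partial>lborel) = 1 \<longrightarrow>
             (\<forall>t\<ge>0.
                enn2ereal (wL1_norm k (\<lambda>v. U t f0 v - maxwellian v))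
                \<ge> ereal (exp (- \<Lambda>)) * enn2ereal (\<integral>\<^sup>+v\<in>{v. norm v > t powr (1 / \<bar>\<gamma>\<bar>)}.
                                ennreal (japanese v powr k * f0 v) \<partial>lborel)
                  - ereal (C2 * exp (- (t powr (2 / \<bar>\<gamma>\<bar>)) / 4)))"
    proof (intro exI[of _ K] conjI allI impI)
      fix f0 :: "'a \<Rightarrow> real" and t :: real
      assume f0: "integrable lborel f0" "AE v in lborel. 0 \<le> f0 v" and t: "0 \<le> t"
      \<comment> \<open>\<open>R\<close> is the speed at which the bound \<open>\<Lambda> * R powr \<gamma>\<close> of the collision frequency equals
        \<open>\<Lambda> / t\<close>; faster particles collide a bounded number of times on average until \<open>t\<close>.\<close>
      define R where "R = t powr (1 / \<bar>\<gamma>\<bar>)"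
      define S where "S = {v::'a. R < norm v}"
      have R: "0 \<le> R" by (simp add: R_def)
      have R2: "R\<^sup>2 = t powr (2 / \<bar>\<gamma>\<bar>)"
        by (simp add: R_def power2_eq_square flip: powr_add)
      have [measurable]: "S \<in> sets borel" unfolding S_def by measurable
      have [measurable]: "f0 \<in> borel_measurable borel" using f0(1) by auto
      have "L1_bounded_linear (U t)"
        using semigroup t unfolding L1_C0_semigroup_def by blast
      then have "integrable lborel (U t f0)"
        using f0 unfolding L1_bounded_linear_def by blast
      then have [measurable]: "U t f0 \<in> borel_measurable borel" by auto
      have ta: "t * a v \<le> \<Lambda>" if "v \<in> S" for v
      proof (cases "t = 0")
        case False
        then have "0 < R" using t by (simp add: R_def)
        have "max 1 (norm v) powr \<gamma> \<le> R powr \<gamma>"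
          using that gamma \<open>0 < R\<close> by (intro powr_mono2') (auto simp: S_def)
        also have "\<dots> = inverse t"
        proof -
          have "1 / \<bar>\<gamma>\<bar> * \<gamma> = - 1" using gamma by simp
          then show ?thesis
            using t False by (simp only: R_def powr_powr) (simp add: powr_minus)
        qed
        finally have "t * max 1 (norm v) powr \<gamma> \<le> 1"
          using t False by (simp add: field_simps)
        then show ?thesis
          using \<Lambda>(1) by (simp add: a_def mult.left_commute[of t])
      qed (use \<Lambda> in simp)
      have "AE v in lborel. exp (- t * a v) * f0 v \<le> U t f0 v"
        by (rule semigroup_ge_exp[OF semigroup generator positive mass_preserving a_meas a0 a_le L_ge f0 t])
      then have pt: "AE v in lborel. ennreal (exp (- \<Lambda>)) * (ennreal (japanese v powr k * f0 v) * indicator S v)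
          \<le> ennreal (japanese v powr k * \<bar>U t f0 v - maxwellian v\<bar>)
            + ennreal (japanese v powr k * maxwellian v) * indicator S v"
        using f0(2)
      proof eventually_elim
        case (elim v)
        show ?case
        proof (cases "v \<in> S")
          case True
          have "exp (- \<Lambda>) * f0 v \<le> exp (- t * a v) * f0 v"
            using ta[OF True] elim by (intro mult_right_mono) auto
          also have "\<dots> \<le> \<bar>U t f0 v - maxwellian v\<bar> + maxwellian v"
            using elim by linarith
          finally have "japanese v powr k * (exp (- \<Lambda>) * f0 v)
              \<le> japanese v powr k * (\<bar>U t f0 v - maxwellian v\<bar> + maxwellian v)"
            by (intro mult_left_mono) auto
          then have "ennreal (exp (- \<Lambda>) * (japanese v powr k * f0 v))
              \<le> ennreal (japanese v powr k * \<bar>U t f0 v - maxwellian v\<bar> + japanese v powr k * maxwellian v)"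
            by (intro ennreal_leI) (simp add: algebra_simps)
          then show ?thesis
            using True by (simp add: ennreal_mult' maxwellian_nonneg)
        qed simp
      qed
      define X where "X = (\<integral>\<^sup>+v\<in>S. ennreal (japanese v powr k * f0 v) \<partial>lborel)"
      define W where "W = wL1_norm k (\<lambda>v. U t f0 v - maxwellian v)"
      define c where "c = K * exp (- (t powr (2 / \<bar>\<gamma>\<bar>)) / 4)"
      have c: "0 \<le> c" using K by (simp add: c_def)
      have "ennreal (exp (- \<Lambda>)) * X
        = (\<integral>\<^sup>+v. ennreal (exp (- \<Lambda>)) * (ennreal (japanese v powr k * f0 v) * indicator S v) \<partial>lborel)"
        unfolding X_def by (intro nn_integral_cmult[symmetric]) measurable
      also have "\<dots> \<le> (\<integral>\<^sup>+v. ennreal (japanese v powr k * \<bar>U t f0 v - maxwellian v\<bar>)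
            + ennreal (japanese v powr k * maxwellian v) * indicator S v \<partial>lborel)"
        by (rule nn_integral_mono_AE[OF pt])
      also have "\<dots> = W + (\<integral>\<^sup>+v\<in>S. ennreal (japanese v powr k * maxwellian v) \<partial>lborel)"
        unfolding W_def wL1_norm_def by (intro nn_integral_add) measurable
      also have "\<dots> \<le> W + ennreal c"
        unfolding S_def c_def R2[symmetric] by (intro add_left_mono K R)
      finally have "enn2ereal (ennreal (exp (- \<Lambda>)) * X) \<le> enn2ereal (W + ennreal c)"
        by (simp add: less_eq_ennreal.rep_eq)
      then have "ereal (exp (- \<Lambda>)) * enn2ereal X \<le> enn2ereal W + ereal c"
        using c by (simp add: times_ennreal.rep_eq plus_ennreal.rep_eq)
      then have "ereal (exp (- \<Lambda>)) * enn2ereal X - ereal c \<le> enn2ereal W"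
        by (subst ereal_minus_le) auto
      then show "enn2ereal (wL1_norm k (\<lambda>v. U t f0 v - maxwellian v))
                \<ge> ereal (exp (- \<Lambda>)) * enn2ereal (\<integral>\<^sup>+v\<in>{v. norm v > t powr (1 / \<bar>\<gamma>\<bar>)}.
                                ennreal (japanese v powr k * f0 v) \<partial>lborel)
                  - ereal (K * exp (- (t powr (2 / \<bar>\<gamma>\<bar>)) / 4))"
        unfolding X_def W_def c_def S_def R_def .
    qed (use K in simp)
  qed simp
qed

end
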